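(* Let $K$ be a field, $S=K[x_1,\ldots,x_n]$, let $I=(u_1,u_2,\ldots,u_m)\subset S$ be a monomial complete intersection and let $d_i:=\deg(u_i)$ for $1\leq i\leq m$. Assume that $d_1\leq d_2\leq\cdots\leq d_m$. Then $$\operatorname{slength}(I)\leq 1+d_1+d_1d_2+\cdots+d_1d_2\cdots d_{m-1}.$$
   Context: Let $M$ be a finitely generated $\mathbb Z^n$-graded $S$-module, $S=K[x_1,\ldots,x_n]$. A Stanley decomposition of $M$ is a finite direct sum of $K$-vector spaces $\mathcal D: M=\bigoplus_{i=1}^r m_iK[Z_i]$, where each $m_i\in M$ is homogeneous, $Z_i\subset\{x_1,\ldots,x_n\}$, and $m_iK[Z_i]$ is a free $K[Z_i]$-module. Its length is $\operatorname{slength}(\mathcal D)=r$, and the Stanley length of $M$ is $\operatorname{slength}(M)=\min\{\operatorname{slength}(\mathcal D):\mathcal D\text{ is a Stanley decomposition of }M\}$. Here $u_1,\ldots,u_m$ are the minimal monomial generators of $I$, and $I$ being a monomial complete intersection means they form a regular sequence, equivalently they are pairwise coprime nonunit monomials. *)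

theory Defs
  imports
    Complex_Main
    "HOL-Library.FuncSet"
    "HOL-Library.Poly_Mapping"
    "HOL-Library.Extended_Nat"
begin

text \<open>
  The polynomial ring \<open>K[x\<^sub>1,\<dots>,x\<^sub>n]\<close> has its variables indexed by a finite type \<open>'n\<close> with \<open>n\<close>
  elements; a polynomial is a finitely supported function from exponent vectors to coefficients,
  with the convolution product of \<open>Poly_Mapping\<close>.
\<close>

type_synonym ('n, 'k) mpoly = "('n \<Rightarrow>\<^sub>0 nat) \<Rightarrow>\<^sub>0 'k"

definition is_monomial :: "('n, 'k::field) mpoly \<Rightarrow> bool"
  where "is_monomial p \<longleftrightarrow> (\<exists>e. p = Poly_Mapping.single e 1)"

text \<open>Total degree; the inserted \<open>0\<close> only fixes the degree of the zero polynomial.\<close>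

definition total_degree :: "('n, 'k::field) mpoly \<Rightarrow> nat"
  where "total_degree p =
    Max (insert 0 ((\<lambda>e. \<Sum>i\<in>Poly_Mapping.keys e. Poly_Mapping.lookup e i) ` Poly_Mapping.keys p))"

definition polys_in :: "'n set \<Rightarrow> ('n, 'k::field) mpoly set"  \<comment> \<open>the subring \<open>K[Z]\<close>\<close>
  where "polys_in Z = {p. \<forall>e\<in>Poly_Mapping.keys p. Poly_Mapping.keys e \<subseteq> Z}"

text \<open>The component of the ring in multidegree \<open>a \<in> \<int>\<^sup>n\<close>; it is \<open>0\<close> unless all \<open>a i \<ge> 0\<close>.\<close>

definition multidegree_component :: "('n \<Rightarrow> int) \<Rightarrow> ('n, 'k::field) mpoly set"
  where "multidegree_component a =
    {p. \<forall>e\<in>Poly_Mapping.keys p. \<forall>i. int (Poly_Mapping.lookup e i) = a i}"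

text \<open>The ideal generated by \<open>B\<close> is the span of \<open>B\<close> in the ring regarded as a module over itself.\<close>

lemma module_times: "module ((*) :: 'a::comm_ring_1 \<Rightarrow> 'a \<Rightarrow> 'a)"
  by unfold_locales (simp_all add: algebra_simps)

definition ideal_generated :: "'a::comm_ring_1 set \<Rightarrow> 'a set"
  where "ideal_generated B = module.span (*) B"

lemma ideal_generated_explicit:
  "ideal_generated B = {(\<Sum>b\<in>T. r b * b) | T r. finite T \<and> T \<subseteq> B}"
  unfolding ideal_generated_def by (rule module.span_explicit[OF module_times])

definition minimal_monomial_generators :: "('n, 'k::field) mpoly set \<Rightarrow> ('n, 'k) mpoly set \<Rightarrow> bool"
  where "minimal_monomial_generators G I \<longleftrightarrow>
    (\<forall>p\<in>G. is_monomial p) \<and> ideal_generated G = I \<and> (\<forall>H. H \<subset> G \<longrightarrow> ideal_generated H \<noteq> I)"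

text \<open>
  \<open>u 1, \<dots>, u m\<close> is a regular sequence: each \<open>u i\<close> is a nonzerodivisor modulo \<open>(u 1, \<dots>, u (i - 1))\<close>,
  and the quotient by the whole sequence is nonzero.
\<close>

definition regular_sequence :: "nat \<Rightarrow> (nat \<Rightarrow> 'a::comm_ring_1) \<Rightarrow> bool"
  where "regular_sequence m u \<longleftrightarrow>
    (\<forall>i\<in>{1..m}. \<forall>f. u i * f \<in> ideal_generated (u ` {1..<i}) \<longrightarrow> f \<in> ideal_generated (u ` {1..<i})) \<and>
    ideal_generated (u ` {1..m}) \<noteq> UNIV"

definition monomial_complete_intersection ::
    "nat \<Rightarrow> (nat \<Rightarrow> ('n, 'k::field) mpoly) \<Rightarrow> ('n, 'k) mpoly set \<Rightarrow> bool"
  where "monomial_complete_intersection m u I \<longleftrightarrow>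
    inj_on u {1..m} \<and> minimal_monomial_generators (u ` {1..m}) I \<and> regular_sequence m u"

text \<open>
  A \<open>\<int>\<^sup>n\<close>-graded module is given by its scalar multiplication \<open>scale\<close>, its carrier \<open>M\<close> and the family
  \<open>C\<close> of its homogeneous components. A Stanley decomposition is the list of its pairs
  \<open>(m\<^sub>i, Z\<^sub>i)\<close>. The cyclic \<open>K[Z]\<close>-module \<open>m K[Z]\<close> is free (on \<open>m\<close>) when \<open>f \<mapsto> f m\<close> is injective on
  \<open>K[Z]\<close>; \<open>M\<close> is the internal direct sum of the \<open>m\<^sub>i K[Z\<^sub>i]\<close> when addition is a bijection from
  their product onto \<open>M\<close>.
\<close>

definition stanley_space ::
    "(('n, 'k::field) mpoly \<Rightarrow> 'm::ab_group_add \<Rightarrow> 'm) \<Rightarrow> 'm \<times> 'n set \<Rightarrow> 'm set"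
  where "stanley_space scale mZ = (\<lambda>f. scale f (fst mZ)) ` polys_in (snd mZ)"

definition stanley_decomposition ::
    "(('n, 'k::field) mpoly \<Rightarrow> 'm::ab_group_add \<Rightarrow> 'm) \<Rightarrow> 'm set \<Rightarrow> (('n \<Rightarrow> int) \<Rightarrow> 'm set) \<Rightarrow>
      ('m \<times> 'n set) list \<Rightarrow> bool"
  where "stanley_decomposition scale M C D \<longleftrightarrow>
    (\<forall>(m, Z)\<in>set D. m \<in> M \<and> (\<exists>a. m \<in> C a) \<and> inj_on (\<lambda>f. scale f m) (polys_in Z)) \<and>
    bij_betw (\<lambda>v. \<Sum>i<length D. v i) (\<Pi>\<^sub>E i\<in>{..<length D}. stanley_space scale (D ! i)) M"

text \<open>
  The minimum is taken in \<open>enat\<close>, so that a module without any Stanley decomposition would have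
  length \<open>\<infinity>\<close>; an upper bound therefore always asserts that a decomposition exists.
\<close>

definition stanley_length ::
    "(('n, 'k::field) mpoly \<Rightarrow> 'm::ab_group_add \<Rightarrow> 'm) \<Rightarrow> 'm set \<Rightarrow> (('n \<Rightarrow> int) \<Rightarrow> 'm set) \<Rightarrow> enat"
  where "stanley_length scale M C = (INF D\<in>{D. stanley_decomposition scale M C D}. enat (length D))"

text \<open>A monomial ideal, as a graded submodule of the polynomial ring.\<close>

definition slength_ideal :: "('n, 'k::field) mpoly set \<Rightarrow> enat"
  where "slength_ideal I = stanley_length (*) I (\<lambda>a. I \<inter> multidegree_component a)"

end

theory Submission
  imports Defs "HOL-Library.Disjoint_Sets"
begin

text \<open>
  The monomials of \<open>I\<close> are sorted by the first generator that divides them. The exponents not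
  divisible by \<open>u j\<close> split into \<open>deg (u j)\<close> cones \<open>b + \<nat>\<^sup>Z\<close>: take the first variable whose exponent
  is too small, and the value of that exponent. As the intersection of two cones is empty or a cone,
  the exponents with first divisor \<open>u k\<close> split into at most \<open>d 1 \<cdots> d (k - 1)\<close> cones, and a partition
  of the exponents of \<open>I\<close> into cones is a Stanley decomposition.
\<close>

section \<open>Partitions into cones\<close>

text \<open>These are the exponents of the monomials in \<open>x^b K[Z]\<close>. Plain functions
  replace finitely supported ones, so that the counting is about functions only.\<close>

definition cone :: "('n \<Rightarrow> nat) \<Rightarrow> 'n set \<Rightarrow> ('n \<Rightarrow> nat) set"
  where "cone b Z = {a. \<forall>i. b i \<le> a i \<and> (i \<notin> Z \<longrightarrow> a i = b i)}"

text \<open>A cone is never empty, so \<open>weaken\<close> is what turns \<open>N\<close> into an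
  upper bound for the number of cones. Intersections can then lose cones without changing the
  count.\<close>

inductive cone_partition :: "nat \<Rightarrow> ('n \<Rightarrow> nat) set \<Rightarrow> bool"
  where
    empty: "cone_partition 0 {}"
  | weaken: "cone_partition N A \<Longrightarrow> cone_partition (Suc N) A"
  | add_cone: "cone_partition N A \<Longrightarrow> A \<inter> cone b Z = {} \<Longrightarrow> cone_partition (Suc N) (A \<union> cone b Z)"

lemma cone_partition_cone: "cone_partition 1 (cone b Z)"
  using add_cone[OF empty, of b Z] by simp

lemma cone_partition_mono: "cone_partition N A \<Longrightarrow> N \<le> M \<Longrightarrow> cone_partition M A"
  by (rotate_tac, induction rule: dec_induct) (auto intro: weaken)

text \<open>The candidate has the componentwise maximum as base and the common free directions. It
  is correct as soon as the two cones share a point.\<close>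

lemma cone_Int_cone: "cone b Z \<inter> cone c Y = {} \<or> (\<exists>e W. cone b Z \<inter> cone c Y = cone e W)"
proof (cases "cone b Z \<inter> cone c Y = {}")
  case False
  then obtain x where x: "x \<in> cone b Z" "x \<in> cone c Y" by auto
  have "cone b Z \<inter> cone c Y = cone (\<lambda>i. max (b i) (c i)) (Z \<inter> Y)"
  proof (intro set_eqI)
    fix a
    have "(b i \<le> a i \<and> (i \<notin> Z \<longrightarrow> a i = b i)) \<and> (c i \<le> a i \<and> (i \<notin> Y \<longrightarrow> a i = c i)) \<longleftrightarrow>
        max (b i) (c i) \<le> a i \<and> (i \<notin> Z \<inter> Y \<longrightarrow> a i = max (b i) (c i))" for i
    proof -
      \<comment> \<open>The common point settles the fixed coordinates: for \<open>i\<close> outside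
        \<open>Z\<close> it gives \<open>b i = x i\<close>, hence \<open>c i \<le> b i\<close>, so
        the maximum is the fixed value \<open>b i\<close>. The same holds for
        \<open>Y\<close>.\<close>
      have "b i \<le> x i \<and> (i \<notin> Z \<longrightarrow> x i = b i)" "c i \<le> x i \<and> (i \<notin> Y \<longrightarrow> x i = c i)"
        using x by (simp_all add: cone_def)
      then show ?thesis by (cases "i \<in> Z"; cases "i \<in> Y") auto
    qed
    then show "a \<in> cone b Z \<inter> cone c Y \<longleftrightarrow> a \<in> cone (\<lambda>i. max (b i) (c i)) (Z \<inter> Y)"
      unfolding cone_def Int_iff mem_Collect_eq by (metis (no_types, lifting))
  qed
  then show ?thesis by blast
qed simp

lemma cone_partition_Un:
  assumes "cone_partition N A" "cone_partition M B" "A \<inter> B = {}"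
  shows "cone_partition (N + M) (A \<union> B)"
  using assms(2,3)
proof (induction rule: cone_partition.induct)
  case empty
  then show ?case using assms(1) by simp
next
  case (weaken M B)
  then show ?case by (simp add: cone_partition.weaken)
next
  case (add_cone M B b Z)
  then have "cone_partition (Suc (N + M)) ((A \<union> B) \<union> cone b Z)"
    by (intro cone_partition.add_cone) auto
  then show ?case by (simp add: Un_assoc)
qed

text \<open>The count does not grow, since every cone of the partition becomes a single cone or
  vanishes.\<close>

lemma cone_partition_Int_cone:
  assumes "cone_partition N A"
  shows "cone_partition N (A \<inter> cone c Y)"
  using assms
proof (induction rule: cone_partition.induct)
  case (add_cone N A b Z)
  consider "cone b Z \<inter> cone c Y = {}" | e W where "cone b Z \<inter> cone c Y = cone e W"
    using cone_Int_cone by metis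
  then show ?case
  proof cases
    case 1
    \<comment> \<open>The cone vanishes here; \<open>weaken\<close> still counts it.\<close>
    then show ?thesis using add_cone.IH by (simp add: Int_Un_distrib2 cone_partition.weaken)
  next
    case 2
    have "cone_partition (Suc N) ((A \<inter> cone c Y) \<union> cone e W)"
      using add_cone 2 by (intro cone_partition.add_cone) auto
    then show ?thesis by (simp add: Int_Un_distrib2 2)
  qed
qed (auto intro: cone_partition.intros)

text \<open>Each of the at most \<open>M\<close> cones of \<open>B\<close> cuts \<open>A\<close>
  into at most \<open>N\<close> cones, and the pieces for different cones are disjoint.\<close>

lemma cone_partition_Int:
  assumes "cone_partition N A" "cone_partition M B"
  shows "cone_partition (N * M) (A \<inter> B)"
  using assms(2)
proof (induction rule: cone_partition.induct)
  case empty
  then show ?case by (simp add: cone_partition.empty)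
next
  case (weaken M B)
  show ?case by (rule cone_partition_mono[OF weaken.IH]) simp
next
  case (add_cone M B b Z)
  have "cone_partition (N * M + N) ((A \<inter> B) \<union> (A \<inter> cone b Z))"
    using add_cone by (intro cone_partition_Un cone_partition_Int_cone assms) auto
  then show ?case by (simp add: Int_Un_distrib add.commute)
qed

section \<open>Counting cones of multiples and non-multiples\<close>

lemma cone_partition_less: "cone_partition N {a. a x < N}"
proof (induction N)
  case 0
  then show ?case by (simp add: cone_partition.empty)
next
  case (Suc N)
  \<comment> \<open>A slice with one coordinate fixed is a cone in which all other directions are
    free.\<close>
  have eq: "{a. a x = N} = cone (\<lambda>i. if i = x then N else 0) (- {x})"
    by (auto simp: cone_def)
  have "{a. a x < N} \<inter> {a. a x = N} = {}" by auto
  then have "cone_partition (Suc N) ({a. a x < N} \<union> {a. a x = N})"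
    unfolding eq by (rule cone_partition.add_cone[OF Suc])
  moreover have "{a. a x < N} \<union> {a. a x = N} = {a. a x < Suc N}" by auto
  ultimately show ?case by simp
qed

text \<open>The new points for \<open>x\<close> are those with \<open>a x < e x\<close> and no
  deficient coordinate in \<open>X\<close>. The second condition defines the single cone
  \<open>?C\<close>, so the \<open>e x\<close> slices remain at most \<open>e x\<close> cones and
  the bounds add up.\<close>

lemma cone_partition_bex_less:
  assumes "finite X"
  shows "cone_partition (\<Sum>i\<in>X. e i) {a. \<exists>i\<in>X. a i < e i}"
  using assms
proof (induction X)
  case empty
  then show ?case by (simp add: cone_partition.empty)
next
  case (insert x X)
  let ?C = "cone (\<lambda>i. if i \<in> X then e i else 0) UNIV"
  have C: "?C = {a. \<forall>i\<in>X. e i \<le> a i}"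
    by (auto simp: cone_def)
  have "cone_partition (sum e X + e x) ({a. \<exists>i\<in>X. a i < e i} \<union> ({a. a x < e x} \<inter> ?C))"
    by (intro cone_partition_Un insert.IH cone_partition_Int_cone cone_partition_less)
      (auto simp: C not_less)
  moreover have "{a. \<exists>i\<in>X. a i < e i} \<union> ({a. a x < e x} \<inter> ?C) = {a. \<exists>i\<in>insert x X. a i < e i}"
    unfolding C by (auto simp: not_less)
  ultimately show ?case using insert by (simp add: add.commute)
qed

text \<open>The inner sum is the degree of the monomial with exponent \<open>e j\<close>.
  Intersecting over \<open>J\<close> multiplies these degrees.\<close>

lemma cone_partition_no_multiple:
  fixes e :: "'j \<Rightarrow> 'n \<Rightarrow> nat"
  assumes "finite J" "\<And>j. j \<in> J \<Longrightarrow> finite {i. e j i \<noteq> 0}"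
  shows "cone_partition (\<Prod>j\<in>J. \<Sum>i | e j i \<noteq> 0. e j i) {a. \<forall>j\<in>J. \<not> e j \<le> a}"
  using assms
proof (induction J)
  case empty
  \<comment> \<open>With nothing to avoid, the whole space is one cone, matching the empty product
    1.\<close>
  have "cone (\<lambda>_. 0) UNIV = (UNIV :: ('n \<Rightarrow> nat) set)" by (auto simp: cone_def)
  then show ?case using cone_partition_cone[of "\<lambda>_ :: 'n. 0" UNIV] by simp
next
  case (insert j J)
  \<comment> \<open>A coordinate with \<open>e j i = 0\<close> can never be deficient, so the
    support of \<open>e j\<close> suffices.\<close>
  have "{a. \<not> e j \<le> a} = {a. \<exists>i\<in>{i. e j i \<noteq> 0}. a i < e j i}"
    by (auto simp: le_fun_def not_le) (metis le_less_trans le0)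
  moreover have "{a. \<forall>j\<in>insert j J. \<not> e j \<le> a} = {a. \<not> e j \<le> a} \<inter> {a. \<forall>j\<in>J. \<not> e j \<le> a}"
    by auto
  ultimately show ?case
    using insert cone_partition_Int[OF cone_partition_bex_less[of "{i. e j i \<noteq> 0}" "e j"]] by simp
qed

text \<open>Summand \<open>k\<close> counts the exponents whose first divisor is
  \<open>e (Suc k)\<close>: they avoid the multiples of \<open>e 1\<close>, ..., \<open>e k\<close>
  and lie in the single cone of multiples of \<open>e (Suc k)\<close>, which adds no further
  factor.\<close>

lemma cone_partition_multiples:
  fixes e :: "nat \<Rightarrow> 'n \<Rightarrow> nat"
  assumes "\<And>j. j \<in> {1..m} \<Longrightarrow> finite {i. e j i \<noteq> 0}"
  shows "cone_partition (\<Sum>k<m. \<Prod>j\<in>{1..k}. \<Sum>i | e j i \<noteq> 0. e j i) {a. \<exists>j\<in>{1..m}. e j \<le> a}"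
  using assms
proof (induction m)
  case 0
  then show ?case by (simp add: cone_partition.empty)
next
  case (Suc m)
  let ?A = "{a. \<exists>j\<in>{1..m}. e j \<le> a}" and ?B = "{a. \<forall>j\<in>{1..m}. \<not> e j \<le> a} \<inter> cone (e (Suc m)) UNIV"
  have "cone_partition ((\<Sum>k<m. \<Prod>j\<in>{1..k}. \<Sum>i | e j i \<noteq> 0. e j i) +
      (\<Prod>j\<in>{1..m}. \<Sum>i | e j i \<noteq> 0. e j i)) (?A \<union> ?B)"
    using Suc by (intro cone_partition_Un cone_partition_Int_cone cone_partition_no_multiple) auto
  moreover have "cone (e (Suc m)) UNIV = {a. e (Suc m) \<le> a}"
    by (auto simp: cone_def le_fun_def)
  then have "?A \<union> ?B = {a. \<exists>j\<in>{1..Suc m}. e j \<le> a}"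
    by (auto simp: atLeastAtMostSuc_conv)
  ultimately show ?case by simp
qed

text \<open>This passes from the inductive form, suited to counting, to an indexed list as in
  \<open>stanley_decomposition\<close>.\<close>

lemma cone_partition_list:
  assumes "cone_partition N A"
  obtains L where "length L \<le> N" "A = (\<Union>i<length L. case_prod cone (L ! i))"
    "disjoint_family_on (\<lambda>i. case_prod cone (L ! i)) {..<length L}"
proof -
  have "\<exists>L. length L \<le> N \<and> A = (\<Union>i<length L. case_prod cone (L ! i)) \<and>
    disjoint_family_on (\<lambda>i. case_prod cone (L ! i)) {..<length L}"
    using assms
  proof (induction rule: cone_partition.induct)
    case empty
    then show ?case by (intro exI[of _ "[]"]) (simp add: disjoint_family_on_def)
  next
    case (weaken N A)
    then show ?case using le_SucI by blast
  next
    case (add_cone N A b Z)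
    then obtain L where L: "length L \<le> N" "A = (\<Union>i<length L. case_prod cone (L ! i))"
      "disjoint_family_on (\<lambda>i. case_prod cone (L ! i)) {..<length L}" by blast
    have disj: "case_prod cone (L ! i) \<inter> cone b Z = {}" if "i < length L" for i
    proof -
      have "case_prod cone (L ! i) \<subseteq> A"
        unfolding L(2) by (rule UN_upper) (simp add: that)
      then show ?thesis using add_cone.hyps(2) by (meson disjoint_iff subsetD)
    qed
    have "disjoint_family_on (\<lambda>i. case_prod cone ((L @ [(b, Z)]) ! i)) {..<length (L @ [(b, Z)])}"
      unfolding disjoint_family_on_def
    proof (intro ballI impI)
      fix i j assume ij: "i \<in> {..<length (L @ [(b, Z)])}" "j \<in> {..<length (L @ [(b, Z)])}" "i \<noteq> j"
      then consider "i < length L" "j < length L" | "i < length L" "j = length L"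
        | "i = length L" "j < length L" by fastforce
      then show "case_prod cone ((L @ [(b, Z)]) ! i) \<inter> case_prod cone ((L @ [(b, Z)]) ! j) = {}"
      proof cases
        case 1
        then show ?thesis using disjoint_family_onD[OF L(3), of i j] ij(3) by (simp add: nth_append)
      next
        case 2
        then show ?thesis using disj[of i] by (simp add: nth_append)
      next
        case 3
        then show ?thesis using disj[of j] by (simp add: nth_append Int_commute)
      qed
    qed
    moreover have "A \<union> cone b Z =
        (\<Union>i<length (L @ [(b, Z)]). case_prod cone ((L @ [(b, Z)]) ! i))"
      unfolding L(2) by (auto simp: nth_append lessThan_Suc)
    ultimately show ?case using L(1) by (intro exI[of _ "L @ [(b, Z)]"]) simp
  qed
  then show thesis using that by blast
qed

section \<open>Polynomials with prescribed exponents\<close>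

text \<open>The \<open>K\<close>-span of the monomials with exponent in \<open>X\<close>; both
  Stanley spaces of monomials and monomial ideals take this form.\<close>

definition polys_on :: "('n \<Rightarrow> nat) set \<Rightarrow> ('n, 'k::field) mpoly set"
  where "polys_on X = {p. \<forall>e\<in>Poly_Mapping.keys p. Poly_Mapping.lookup e \<in> X}"

section \<open>Monomial expansion and multiplication by a monomial\<close>

lemma poly_mapping_sum_single:
  "(\<Sum>e\<in>Poly_Mapping.keys p. Poly_Mapping.single e (Poly_Mapping.lookup p e)) = p"
  by (rule poly_mapping_eqI) (auto simp: lookup_sum lookup_single when_def in_keys_iff)

lemma lookup_times_single:
  fixes p :: "('n, 'k::field) mpoly"
  shows "Poly_Mapping.lookup (p * Poly_Mapping.single b 1) (e + b) = Poly_Mapping.lookup p e"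
proof -
  \<comment> \<open>This is the inner sum of the convolution formula: only \<open>q = b\<close>
    contributes, and then cancelling \<open>b\<close> forces \<open>l = e\<close>.\<close>
  have "(\<Sum>q. Poly_Mapping.lookup (Poly_Mapping.single b (1::'k)) q when e + b = l + q) =
      (1 when l = e)" for l
  proof -
    have "(\<lambda>q. Poly_Mapping.lookup (Poly_Mapping.single b (1::'k)) q when e + b = l + q) =
        (\<lambda>q. (1 when l = e) when q = b)"
      by (auto simp: fun_eq_iff lookup_single when_def)
    then show ?thesis by (simp only: Sum_any_when_equal)
  qed
  then show ?thesis by (simp add: lookup_mult mult_when)
qed

text \<open>Injectivity on the whole ring makes a monomial times \<open>K[Z]\<close> free for every
  \<open>Z\<close>.\<close>

lemma inj_times_single: "inj (\<lambda>f :: ('n, 'k::field) mpoly. f * Poly_Mapping.single b 1)"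
  by (intro injI poly_mapping_eqI) (metis lookup_times_single)

lemma stanley_space_single:
  "stanley_space (*) (Poly_Mapping.single b 1 :: ('n, 'k::field) mpoly, Z) =
    polys_on (cone (Poly_Mapping.lookup b) Z)"
proof (intro equalityI subsetI)
  fix p :: "('n, 'k) mpoly"
  assume "p \<in> stanley_space (*) (Poly_Mapping.single b 1, Z)"
  then obtain f where f: "f \<in> polys_in Z" "p = f * Poly_Mapping.single b 1"
    by (auto simp: stanley_space_def)
  show "p \<in> polys_on (cone (Poly_Mapping.lookup b) Z)"
    unfolding polys_on_def
  proof (intro CollectI ballI)
    fix e assume "e \<in> Poly_Mapping.keys p"
    then obtain a where a: "a \<in> Poly_Mapping.keys f" "e = a + b"
      using keys_mult[of f "Poly_Mapping.single b 1"] f(2) by auto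
    then have "Poly_Mapping.keys a \<subseteq> Z"
      using f(1) by (simp add: polys_in_def)
    then show "Poly_Mapping.lookup e \<in> cone (Poly_Mapping.lookup b) Z"
      using a(2) by (auto simp: cone_def lookup_add in_keys_iff)
  qed
next
  fix p :: "('n, 'k) mpoly"
  assume p: "p \<in> polys_on (cone (Poly_Mapping.lookup b) Z)"
  \<comment> \<open>This is \<open>p\<close> divided termwise by the monomial. The truncated
    subtraction is exact because \<open>b\<close> lies below every exponent of
    \<open>p\<close>.\<close>
  define f where
    "f = (\<Sum>e\<in>Poly_Mapping.keys p. Poly_Mapping.single (e - b) (Poly_Mapping.lookup p e))"
  have "e - b + b = e" if "e \<in> Poly_Mapping.keys p" for e
    using p that by (intro poly_mapping_eqI) (auto simp: polys_on_def cone_def lookup_add lookup_minus)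
  then have "f * Poly_Mapping.single b 1 = p"
    by (simp add: f_def sum_distrib_right mult_single poly_mapping_sum_single)
  moreover have "Poly_Mapping.keys (e - b) \<subseteq> Z" if "e \<in> Poly_Mapping.keys p" for e
  proof
    fix i assume "i \<in> Poly_Mapping.keys (e - b)"
    then have "Poly_Mapping.lookup e i \<noteq> Poly_Mapping.lookup b i"
      by (auto simp: in_keys_iff lookup_minus)
    then show "i \<in> Z" using p that by (auto simp: polys_on_def cone_def)
  qed
  then have "f \<in> polys_in Z"
    using keys_sum[of "\<lambda>e. Poly_Mapping.single (e - b) (Poly_Mapping.lookup p e)" "Poly_Mapping.keys p"]
    by (fastforce simp: f_def polys_in_def split: if_splits)
  ultimately show "p \<in> stanley_space (*) (Poly_Mapping.single b 1, Z)"
    by (auto simp: stanley_space_def)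
qed

text \<open>By disjointness, the coefficient of a sum at an exponent in \<open>X j\<close> comes
  from the summand \<open>v j\<close> alone. Hence the sum determines its summands.\<close>

lemma bij_betw_sum_polys_on:
  fixes X :: "'i \<Rightarrow> ('n \<Rightarrow> nat) set"
  assumes "finite J" "disjoint_family_on X J"
  shows "bij_betw (\<lambda>v. \<Sum>i\<in>J. v i) (\<Pi>\<^sub>E i\<in>J. polys_on (X i) :: ('n, 'k::field) mpoly set)
    (polys_on (\<Union>i\<in>J. X i))"
proof -
  have zero: "Poly_Mapping.lookup p e = 0"
    if "p \<in> polys_on Y" "Poly_Mapping.lookup e \<notin> Y" for p :: "('n, 'k) mpoly" and Y e
    using that by (auto simp: polys_on_def in_keys_iff)
  have lookup_component: "Poly_Mapping.lookup (\<Sum>i\<in>J. v i) e = Poly_Mapping.lookup (v j) e"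
    if "v \<in> (\<Pi>\<^sub>E i\<in>J. polys_on (X i) :: ('n, 'k) mpoly set)" "j \<in> J" "Poly_Mapping.lookup e \<in> X j"
    for v j e
  proof -
    have "Poly_Mapping.lookup (v i) e = 0" if "i \<in> J" "i \<noteq> j" for i
      using assms(2) \<open>v \<in> _\<close> \<open>j \<in> J\<close> \<open>_ \<in> X j\<close> that
      by (intro zero[of _ "X i"]) (auto simp: disjoint_family_on_def)
    then show ?thesis
      by (simp add: sum.remove[OF assms(1) that(2)] lookup_add lookup_sum)
  qed
  have "inj_on (\<lambda>v. \<Sum>i\<in>J. v i) (\<Pi>\<^sub>E i\<in>J. polys_on (X i) :: ('n, 'k) mpoly set)"
  proof (intro inj_onI)
    fix v w
    assume vw: "v \<in> (\<Pi>\<^sub>E i\<in>J. polys_on (X i) :: ('n, 'k) mpoly set)" "w \<in> (\<Pi>\<^sub>E i\<in>J. polys_on (X i))"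
      and eq: "(\<Sum>i\<in>J. v i) = (\<Sum>i\<in>J. w i)"
    show "v = w"
    proof (rule PiE_ext[OF vw], rule poly_mapping_eqI)
      fix j e assume j: "j \<in> J"
      then have mem: "v j \<in> polys_on (X j)" "w j \<in> polys_on (X j)" using vw by auto
      show "Poly_Mapping.lookup (v j) e = Poly_Mapping.lookup (w j) e"
      proof (cases "Poly_Mapping.lookup e \<in> X j")
        case True
        then show ?thesis
          using lookup_component[OF vw(1) j] lookup_component[OF vw(2) j] eq by metis
      next
        case False
        then show ?thesis using mem zero by metis
      qed
    qed
  qed
  moreover have "(\<Sum>i\<in>J. v i) \<in> polys_on (\<Union>i\<in>J. X i)"
    if "v \<in> (\<Pi>\<^sub>E i\<in>J. polys_on (X i) :: ('n, 'k) mpoly set)" for v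
    using that keys_sum[of v J] by (fastforce simp: polys_on_def)
  moreover have "\<exists>v\<in>(\<Pi>\<^sub>E i\<in>J. polys_on (X i)). (\<Sum>i\<in>J. v i) = p"
    if p: "p \<in> polys_on (\<Union>i\<in>J. X i)" for p :: "('n, 'k) mpoly"
  proof
    \<comment> \<open>The summands of \<open>p\<close> are its restrictions to the sets
      \<open>X i\<close>; outside \<open>J\<close> the family is undefined, as the extensional
      product demands.\<close>
    define v where "v = (\<lambda>i\<in>J. Poly_Mapping.mapp (\<lambda>e c. if Poly_Mapping.lookup e \<in> X i then c else 0) p)"
    show v: "v \<in> (\<Pi>\<^sub>E i\<in>J. polys_on (X i))"
      by (auto simp: v_def polys_on_def in_keys_iff lookup_mapp when_def split: if_splits)
    show "(\<Sum>i\<in>J. v i) = p"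
    proof (rule poly_mapping_eqI)
      fix e
      show "Poly_Mapping.lookup (\<Sum>i\<in>J. v i) e = Poly_Mapping.lookup p e"
      proof (cases "\<exists>j\<in>J. Poly_Mapping.lookup e \<in> X j")
        case True
        then obtain j where j: "j \<in> J" "Poly_Mapping.lookup e \<in> X j" by blast
        then show ?thesis
          using lookup_component[OF v j] by (simp add: v_def lookup_mapp when_def in_keys_iff)
      next
        case False
        then have "Poly_Mapping.lookup (v i) e = 0" if "i \<in> J" for i
          using that by (simp add: v_def lookup_mapp)
        moreover have "Poly_Mapping.lookup p e = 0"
          using False by (intro zero[OF p]) auto
        ultimately show ?thesis by (simp add: lookup_sum)
      qed
    qed
  qed
  ultimately show ?thesis
    unfolding bij_betw_def by blast
qed

text \<open>Each cone \<open>cone b Z\<close> contributes the pair of the monomial with exponent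
  \<open>b\<close> and \<open>Z\<close>; disjointness of the cones yields the direct sum.\<close>

lemma slength_polys_on_le:
  fixes A :: "('n::finite \<Rightarrow> nat) set"
  assumes "cone_partition N A"
  shows "slength_ideal (polys_on A :: ('n, 'k::field) mpoly set) \<le> enat N"
proof -
  obtain L where L: "length L \<le> N" "A = (\<Union>i<length L. case_prod cone (L ! i))"
    "disjoint_family_on (\<lambda>i. case_prod cone (L ! i)) {..<length L}"
    using cone_partition_list[OF assms] .
  define D where "D = map (\<lambda>(b, Z). (Poly_Mapping.single (Abs_poly_mapping b) (1::'k), Z)) L"
  have length_D: "length D = length L" by (simp add: D_def)
  \<comment> \<open>Since \<open>'n\<close> is finite, every function has finite support and is a
    legitimate exponent vector.\<close>
  have lookup_Abs: "Poly_Mapping.lookup (Abs_poly_mapping b) = b" for b :: "'n \<Rightarrow> nat"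
    by simp
  have space: "stanley_space (*) (D ! i) = polys_on (case_prod cone (L ! i))" if "i < length L" for i
    using that by (cases "L ! i") (simp add: D_def stanley_space_single lookup_Abs)
  have "bij_betw (\<lambda>v. \<Sum>i<length D. v i) (\<Pi>\<^sub>E i\<in>{..<length D}. stanley_space (*) (D ! i)) (polys_on A)"
  proof -
    have "(\<Pi>\<^sub>E i\<in>{..<length D}. stanley_space (*) (D ! i)) =
        (\<Pi>\<^sub>E i\<in>{..<length L}. polys_on (case_prod cone (L ! i)))"
      unfolding length_D by (intro PiE_cong) (simp add: space)
    then show ?thesis
      using bij_betw_sum_polys_on[OF finite_lessThan L(3)] by (simp add: length_D L(2))
  qed
  moreover have "q \<in> polys_on A \<and> (\<exists>a. q \<in> polys_on A \<inter> multidegree_component a) \<and>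
      inj_on (\<lambda>f. f * q) (polys_in Z)" if qZ: "(q, Z) \<in> set D" for q Z
  proof -
    obtain i b where i: "i < length L" "L ! i = (b, Z)"
      and q: "q = Poly_Mapping.single (Abs_poly_mapping b) 1"
      using qZ by (auto simp: D_def in_set_conv_nth)
    \<comment> \<open>The base point lies in its own cone, so the generator belongs to the
      module.\<close>
    have "b \<in> cone b Z" by (simp add: cone_def)
    then have "b \<in> A" unfolding L(2) using i by force
    then have "q \<in> polys_on A" by (simp add: polys_on_def q lookup_Abs)
    moreover have "q \<in> multidegree_component (\<lambda>i. int (b i))"
      by (simp add: multidegree_component_def q lookup_Abs)
    ultimately show ?thesis
      using inj_times_single inj_on_subset unfolding q by blast
  qed
  ultimately have "stanley_decomposition (*) (polys_on A) (\<lambda>a. polys_on A \<inter> multidegree_component a) D"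
    unfolding stanley_decomposition_def by auto
  then have "slength_ideal (polys_on A :: ('n, 'k) mpoly set) \<le> enat (length D)"
    unfolding slength_ideal_def stanley_length_def by (intro INF_lower) simp
  also have "\<dots> \<le> enat N" using L(1) by (simp add: length_D)
  finally show ?thesis .
qed

section \<open>Monomial ideals and the final bound\<close>

lemma ideal_generated_monomials:
  "ideal_generated ((\<lambda>e. Poly_Mapping.single e 1) ` E) =
    (polys_on {a. \<exists>e\<in>E. Poly_Mapping.lookup e \<le> a} :: ('n, 'k::field) mpoly set)"
proof (intro equalityI subsetI)
  fix p :: "('n, 'k) mpoly"
  assume "p \<in> ideal_generated ((\<lambda>e. Poly_Mapping.single e 1) ` E)"
  then obtain T r where T: "finite T" "T \<subseteq> (\<lambda>e. Poly_Mapping.single e 1) ` E"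
    and p: "p = (\<Sum>b\<in>T. r b * b)"
    by (auto simp: ideal_generated_explicit)
  show "p \<in> polys_on {a. \<exists>e\<in>E. Poly_Mapping.lookup e \<le> a}"
    unfolding polys_on_def
  proof (intro CollectI ballI)
    fix a assume "a \<in> Poly_Mapping.keys p"
    then obtain b where b: "b \<in> T" "a \<in> Poly_Mapping.keys (r b * b)"
      \<comment> \<open>Cancellation in the sum can only remove exponents, so each exponent of
        \<open>p\<close> already occurs in some \<open>r b * b\<close>.\<close>
      unfolding p using keys_sum[of "\<lambda>b. r b * b" T] by auto
    then obtain e where e: "e \<in> E" "b = Poly_Mapping.single e 1" using T by auto
    then obtain c where "a = c + e"
      using keys_mult[of "r b" b] b(2) by auto
    then show "\<exists>e\<in>E. Poly_Mapping.lookup e \<le> Poly_Mapping.lookup a"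
      using e(1) by (intro bexI[of _ e]) (simp_all add: le_fun_def lookup_add)
  qed
next
  interpret module "(*) :: ('n, 'k) mpoly \<Rightarrow> _" by (rule module_times)
  fix p :: "('n, 'k) mpoly"
  assume p: "p \<in> polys_on {a. \<exists>e\<in>E. Poly_Mapping.lookup e \<le> a}"
  have "Poly_Mapping.single a c \<in> span ((\<lambda>e. Poly_Mapping.single e 1) ` E)"
    if "e \<in> E" "Poly_Mapping.lookup e \<le> Poly_Mapping.lookup a" for a e and c :: 'k
  proof -
    \<comment> \<open>Divisibility makes the truncated difference exact, so every term of
      \<open>p\<close> is a multiple of a generator.\<close>
    have "a - e + e = a"
      using that(2) by (intro poly_mapping_eqI) (simp add: le_fun_def lookup_add lookup_minus)
    then have "Poly_Mapping.single (a - e) c * Poly_Mapping.single e 1 = Poly_Mapping.single a c"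
      by (simp add: mult_single)
    then show ?thesis
      using that(1) by (metis span_base span_scale imageI)
  qed
  then have "(\<Sum>a\<in>Poly_Mapping.keys p. Poly_Mapping.single a (Poly_Mapping.lookup p a)) \<in>
      span ((\<lambda>e. Poly_Mapping.single e 1) ` E)"
    using p by (intro span_sum) (auto simp: polys_on_def)
  then show "p \<in> ideal_generated ((\<lambda>e. Poly_Mapping.single e 1) ` E)"
    by (simp add: poly_mapping_sum_single ideal_generated_def)
qed

theorem theorem2p21:
  fixes I :: "('n::finite, 'k::field) mpoly set"
    and u :: "nat \<Rightarrow> ('n, 'k) mpoly"
    and d :: "nat \<Rightarrow> nat"
    and m :: nat
  assumes "1 \<le> m"
    and "monomial_complete_intersection m u I"
    and "\<And>i. i \<in> {1..m} \<Longrightarrow> d i = total_degree (u i)"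
    and "\<And>i j. 1 \<le> i \<Longrightarrow> i \<le> j \<Longrightarrow> j \<le> m \<Longrightarrow> d i \<le> d j"
  shows "slength_ideal I \<le> enat (\<Sum>k<m. \<Prod>i\<in>{1..k}. d i)"
proof -
  have I: "I = ideal_generated (u ` {1..m})" and "\<forall>k\<in>{1..m}. is_monomial (u k)"
    using assms(2) by (auto simp: monomial_complete_intersection_def minimal_monomial_generators_def)
  then obtain e where e: "\<And>k. k \<in> {1..m} \<Longrightarrow> u k = Poly_Mapping.single (e k) 1"
    unfolding is_monomial_def by metis
  have support: "{i. Poly_Mapping.lookup a i \<noteq> 0} = Poly_Mapping.keys a" for a :: "'n \<Rightarrow>\<^sub>0 nat"
    by (simp add: keys.rep_eq)
  \<comment> \<open>The only key of \<open>u k\<close> is \<open>e k\<close>, so the maximum in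
    \<open>total_degree\<close> is taken over 0 and the coordinate sum of
    \<open>e k\<close>.\<close>
  have d: "d k = (\<Sum>i | Poly_Mapping.lookup (e k) i \<noteq> 0. Poly_Mapping.lookup (e k) i)"
    if "k \<in> {1..m}" for k
    using assms(3)[OF that] e[OF that] unfolding support by (simp add: total_degree_def)
  have "u ` {1..m} = (\<lambda>a. Poly_Mapping.single a 1) ` e ` {1..m}"
    using e by (auto simp: image_image)
  then have "I = polys_on {a. \<exists>k\<in>{1..m}. Poly_Mapping.lookup (e k) \<le> a}"
    by (simp add: I ideal_generated_monomials)
  \<comment> \<open>From \<open>i \<le> k < m\<close> every index lies in \<open>{1..m}\<close>,
    where \<open>d\<close> is known to be the degree.\<close>
  moreover have "(\<Sum>k<m. \<Prod>i\<in>{1..k}. d i) =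
      (\<Sum>k<m. \<Prod>j\<in>{1..k}. \<Sum>i | Poly_Mapping.lookup (e j) i \<noteq> 0. Poly_Mapping.lookup (e j) i)"
    by (intro sum.cong prod.cong refl d) auto
  ultimately show ?thesis
    using slength_polys_on_le[OF cone_partition_multiples[of m "\<lambda>k. Poly_Mapping.lookup (e k)"]] by simp
qed

end
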